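(* Let $G_1$ and $G_2$ be groups whose commutator subgroups $G_1'$ and $G_2'$ are torsion groups. If the monoids of product-one sequences $\mathcal{B}(G_1)$ and $\mathcal{B}(G_2)$ are isomorphic (as monoids), then the torsion subgroups $\mathsf{T}(G_1)$ and $\mathsf{T}(G_2)$ are isomorphic (as groups).
   Context: Groups are written multiplicatively and may be finite or infinite, abelian or non-abelian; $1_G$ denotes the identity element of a group $G$. A torsion group is a group in which every element has finite order. For a group $G$, $G'$ denotes its commutator subgroup and $\mathsf{T}(G)$ denotes the set of elements of $G$ of finite order. It is well known that if $G'$ is a torsion group, then $\mathsf{T}(G)$ is a subgroup of $G$, called the torsion subgroup of $G$. For a group $G$, let $\mathcal{F}(G)$ denote the free abelian monoid with basis the underlying set of $G$ (equivalently, finite multisets of elements of $G$ under multiset sum). Its elements are called sequences over $G$: finite unordered sequences $S = g_1 \boldsymbol{\cdot} \ldots \boldsymbol{\cdot} g_\ell$ ($\ell \ge 0$, $g_1, \ldots, g_\ell \in G$) with repetition allowed, where $\boldsymbol{\cdot}$ denotes the operation (concatenation) of $\mathcal{F}(G)$, which is distinct from the group operation of $G$. The set of products of $S$ is $$\pi(S) = \{ g_{\tau(1)} g_{\tau(2)} \cdots g_{\tau(\ell)} \in G : \tau \text{ is a permutation of } \{1, \ldots, \ell\} \} \subset G,$$ with the empty sequence (the identity of $\mathcal{F}(G)$) having set of products $\{1_G\}$. The sequence $S$ is called a product-one sequence if $1_G \in \pi(S)$, i.e. if its terms can be ordered so that their product in $G$ equals $1_G$. The monoid of product-one sequences over $G$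 is the submonoid $$\mathcal{B}(G) = \{ S \in \mathcal{F}(G) : 1_G \in \pi(S) \} \subset \mathcal{F}(G).$$ *)

theory Defs
  imports "HOL-Algebra.Algebra" "HOL-Library.Multiset"
begin

section \<open>Torsion\<close>

definition torsion_elements :: "('a, 'm) monoid_scheme \<Rightarrow> 'a set" where
  "torsion_elements G =
     {x \<in> carrier G. \<exists>n::nat. 0 < n \<and> x [^]\<^bsub>G\<^esub> n = \<one>\<^bsub>G\<^esub>}"

definition torsion_group :: "('a, 'm) monoid_scheme \<Rightarrow> bool" where
  "torsion_group G \<longleftrightarrow> group G \<and> torsion_elements G = carrier G"

definition commutator_subgroup :: "('a, 'm) monoid_scheme \<Rightarrow> ('a, 'm) monoid_scheme" where
  "commutator_subgroup G = G\<lparr>carrier := derived G (carrier G)\<rparr>"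

text \<open>For arbitrary \<open>G\<close> this is only the set of elements of finite order with the operation of
  \<open>G\<close>; it is a group when the commutator subgroup of \<open>G\<close> is a torsion group
  (see \<open>subgroup_torsion_elements\<close> below).\<close>

definition torsion_subgroup :: "('a, 'm) monoid_scheme \<Rightarrow> ('a, 'm) monoid_scheme" where
  "torsion_subgroup G = G\<lparr>carrier := torsion_elements G\<rparr>"

lemma (in group) torsion_elements_iff_ord:
  "x \<in> torsion_elements G \<longleftrightarrow> x \<in> carrier G \<and> ord x \<noteq> 0"
  unfolding torsion_elements_def using ord_eq_0 by auto

lemma (in group) subgroup_torsion_elements:
  assumes "torsion_group (commutator_subgroup G)"
  shows "subgroup (torsion_elements G) G"
proof (rule subgroupI)
  let ?D = "derived G (carrier G)"
  interpret D: normal ?D G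
    by (rule derived_self_is_normal)
  interpret Q: comm_group "G Mod ?D"
    by (rule derived_quot_is_comm_group)
  have hom: "group_hom G (G Mod ?D) ((#>) ?D)"
    by (simp add: group_hom_def group_hom_axioms_def is_group D.r_coset_hom_Mod D.factorgroup_is_group)
  interpret h: group_hom G "G Mod ?D" "(#>) ?D"
    by (rule hom)
  have torsD: "\<exists>n::nat. 0 < n \<and> d [^] n = \<one>" if "d \<in> ?D" for d
    using assms that
    by (auto simp: torsion_group_def commutator_subgroup_def torsion_elements_def nat_pow_def)
  show "torsion_elements G \<subseteq> carrier G"
    by (auto simp: torsion_elements_def)
  have "\<one> \<in> torsion_elements G"
    by (auto simp: torsion_elements_def)
  then show "torsion_elements G \<noteq> {}"
    by blast
  show "inv x \<in> torsion_elements G" if "x \<in> torsion_elements G" for x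
    using that by (simp add: torsion_elements_iff_ord ord_inv)
  show "x \<otimes> y \<in> torsion_elements G"
    if "x \<in> torsion_elements G" "y \<in> torsion_elements G" for x y
  proof -
    from that obtain m n :: nat where x: "x \<in> carrier G" "0 < m" "x [^] m = \<one>"
      and y: "y \<in> carrier G" "0 < n" "y [^] n = \<one>"
      by (auto simp: torsion_elements_def)
    have x': "x [^] (m * n) = \<one>"
      using x by (simp flip: nat_pow_pow)
    have y': "y [^] (m * n) = \<one>"
      using y by (metis mult.commute nat_pow_one nat_pow_pow)
    have "?D #> ((x \<otimes> y) [^] (m * n)) = (?D #> (x \<otimes> y)) [^]\<^bsub>G Mod ?D\<^esub> (m * n)"
      using x y by (intro h.hom_nat_pow) auto
    also have "\<dots> = (?D #> x) [^]\<^bsub>G Mod ?D\<^esub> (m * n) \<otimes>\<^bsub>G Mod ?D\<^esub> (?D #> y) [^]\<^bsub>G Mod ?D\<^esub> (m * n)"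
      using x y by (simp only: h.hom_mult Q.nat_pow_distrib h.hom_closed)
    also have "\<dots> = (?D #> (x [^] (m * n))) \<otimes>\<^bsub>G Mod ?D\<^esub> (?D #> (y [^] (m * n)))"
      using x y by (simp only: h.hom_nat_pow)
    also have "\<dots> = \<one>\<^bsub>G Mod ?D\<^esub>"
      by (simp only: x' y' h.hom_one Q.l_one Q.one_closed)
    finally have "?D #> ((x \<otimes> y) [^] (m * n)) = ?D"
      by (simp add: FactGroup_def)
    then have "(x \<otimes> y) [^] (m * n) \<in> ?D"
      using x y by (metis D.subgroup_axioms coset_join1 m_closed nat_pow_closed subgroup.subset)
    then obtain k :: nat where "0 < k" "((x \<otimes> y) [^] (m * n)) [^] k = \<one>"
      using torsD by blast
    then have "0 < m * n * k" "(x \<otimes> y) [^] (m * n * k) = \<one>"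
      using x y by (auto simp: nat_pow_pow)
    then show ?thesis
      using x y unfolding torsion_elements_def by blast
  qed
qed


section \<open>Sequences over a group\<close>

definition sequences :: "('a, 'm) monoid_scheme \<Rightarrow> 'a multiset monoid" where
  "sequences G =
     \<lparr>carrier = {S. set_mset S \<subseteq> carrier G}, monoid.mult = (+), one = {#}\<rparr>"

text \<open>The lists \<open>xs\<close> with \<open>mset xs = S\<close> are exactly the orderings of the terms of \<open>S\<close>.\<close>

definition set_of_products :: "('a, 'm) monoid_scheme \<Rightarrow> 'a multiset \<Rightarrow> 'a set" where
  "set_of_products G S = {foldr (\<otimes>\<^bsub>G\<^esub>) xs \<one>\<^bsub>G\<^esub> | xs. mset xs = S}"

definition product_one :: "('a, 'm) monoid_scheme \<Rightarrow> 'a multiset \<Rightarrow> bool" where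
  "product_one G S \<longleftrightarrow> \<one>\<^bsub>G\<^esub> \<in> set_of_products G S"

definition product_one_monoid :: "('a, 'm) monoid_scheme \<Rightarrow> 'a multiset monoid" where
  "product_one_monoid G =
     (sequences G)\<lparr>carrier := {S \<in> carrier (sequences G). product_one G S}\<rparr>"

lemma comm_monoid_sequences: "comm_monoid (sequences G)"
  by (rule comm_monoidI) (auto simp: sequences_def)

lemma set_of_products_empty: "set_of_products G {#} = {\<one>\<^bsub>G\<^esub>}"
  by (simp add: set_of_products_def)

lemma set_of_products_permutes:
  "set_of_products G (mset xs) =
     {foldr (\<otimes>\<^bsub>G\<^esub>) (permute_list p xs) \<one>\<^bsub>G\<^esub> | p. p permutes {..<length xs}}"
  unfolding set_of_products_def
  by (metis (no_types, opaque_lifting) mset_eq_permutation mset_permute_list)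

lemma (in group) foldr_mult_append:
  assumes "set xs \<subseteq> carrier G" "set ys \<subseteq> carrier G"
  shows "foldr (\<otimes>) (xs @ ys) \<one> = foldr (\<otimes>) xs \<one> \<otimes> foldr (\<otimes>) ys \<one>"
  using assms by (induction xs) (auto simp: m_assoc)

lemma (in group) submonoid_product_one:
  "submonoid (carrier (product_one_monoid G)) (sequences G)"
proof
  show "carrier (product_one_monoid G) \<subseteq> carrier (sequences G)"
    by (auto simp: product_one_monoid_def)
  show "\<one>\<^bsub>sequences G\<^esub> \<in> carrier (product_one_monoid G)"
    by (simp add: product_one_monoid_def product_one_def sequences_def set_of_products_empty)
  show "S \<otimes>\<^bsub>sequences G\<^esub> T \<in> carrier (product_one_monoid G)"
    if ST: "S \<in> carrier (product_one_monoid G)" "T \<in> carrier (product_one_monoid G)" for S T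
  proof -
    obtain xs ys where xs: "mset xs = S" "foldr (\<otimes>) xs \<one> = \<one>"
      and ys: "mset ys = T" "foldr (\<otimes>) ys \<one> = \<one>"
      using ST by (auto simp: product_one_monoid_def product_one_def set_of_products_def)
    have "set xs \<subseteq> carrier G" "set ys \<subseteq> carrier G"
      using ST xs(1) ys(1) by (auto simp: product_one_monoid_def sequences_def)
    then have "foldr (\<otimes>) (xs @ ys) \<one> = \<one>"
      using xs ys foldr_mult_append by simp
    moreover have "mset (xs @ ys) = S + T"
      using xs ys by simp
    ultimately have "\<one> \<in> set_of_products G (S + T)"
      unfolding set_of_products_def by (intro CollectI exI[of _ "xs @ ys"]) simp
    then show ?thesis
      using ST by (auto simp: product_one_monoid_def product_one_def sequences_def)
  qed
qed

text \<open>The library's \<open>hom\<close>, and hence \<open>\<cong>\<close>, does not ask for the identity to be preserved; for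
  bijective homomorphisms this is automatic.\<close>

lemma iso_preserves_one:
  assumes "monoid M" "monoid N" "h \<in> iso M N"
  shows "h \<one>\<^bsub>M\<^esub> = \<one>\<^bsub>N\<^esub>"
proof -
  interpret M: monoid M by fact
  interpret N: monoid N by fact
  from assms(3) have hom: "h \<in> hom M N" and bij: "bij_betw h (carrier M) (carrier N)"
    by (auto simp: iso_def)
  obtain u where u: "u \<in> carrier M" "h u = \<one>\<^bsub>N\<^esub>"
    using bij by (metis N.one_closed bij_betw_iff_bijections)
  have "h \<one>\<^bsub>M\<^esub> \<otimes>\<^bsub>N\<^esub> h u = h u"
    using hom u by (metis M.l_one M.one_closed hom_mult)
  then show ?thesis
    using u hom by (simp add: hom_in_carrier)
qed

end

theory Submission
  imports Defs
begin

text \<open>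
Write \<open>\<B>(G)\<close> for the monoid of product-one sequences. A torsion element \<open>g\<close> of order \<open>n\<close> is
visible in \<open>\<B>(G)\<close> through its block \<open>g\<^sup>n\<close>, the sequence consisting of \<open>n\<close> copies of \<open>g\<close>. The proof
finds the blocks inside the abstract monoid, so that an isomorphism \<open>\<phi>\<close> moves blocks to blocks and
thereby torsion elements to torsion elements, and then shows that this map of elements remembers
the group operation.

Call an element \<open>a \<noteq> 1\<close> of a commutative monoid an element with prime radical if \<open>a\<close> divides a power
of \<open>s\<close> or of \<open>t\<close> whenever it divides \<open>st\<close>. In \<open>\<B>(G)\<close> these are exactly the powers of blocks
(\<open>has_prime_radical_iff_power_of_block\<close>). A block \<open>g\<^sup>n\<close> divides \<open>S\<^sup>n\<close> as soon as \<open>g\<close> occurs in \<open>S\<close>: turn an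
ordering of \<open>S\<close> with product one cyclically until \<open>g\<close> stands first; the remaining terms multiply to
\<open>g\<^sup>-\<^sup>1\<close>, so \<open>n\<close> copies of them multiply to one. Conversely, if \<open>A\<close> has two different terms, then \<open>A\<close>
divides a product \<open>ST\<close> in which \<open>S\<close> and \<open>T\<close> each miss a term of \<open>A\<close>, so that \<open>A\<close> divides no power of
either. In a finite group \<open>S\<close> and \<open>T\<close> are parts of a power of \<open>A\<close>; in an infinite group one completes
each term of \<open>A\<close> to a product-one sequence of length three by means of a generic element.

Hence \<open>\<phi>\<close> sends the block of \<open>g\<close> to the block of some \<open>\<theta>(g)\<close>, and \<open>\<theta>\<close> is a bijection between the
torsion elements, which form a subgroup because the commutators generate a torsion group. If \<open>S\<close>
consists of torsion terms, then \<open>S\<^sup>N\<close> is a product of powers of blocks for a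
suitable \<open>N\<close>, so \<open>\<phi>(S)\<close> is determined by \<open>\<theta>\<close> up to the ratios \<open>ord \<theta>(g) / ord g\<close>. When the torsion
subgroup has at least three elements, every torsion \<open>g\<close> occurs exactly once in some such \<open>S\<close>;
comparing multiplicities gives \<open>ord g\<close> divides \<open>ord \<theta>(g)\<close>, and by symmetry the orders agree. Then
\<open>\<phi>(S)\<close> is the image of \<open>S\<close> under \<open>\<theta>\<close>, term by term. The sequences with terms \<open>g\<close>, \<open>g\<^sup>-\<^sup>1\<close> and with
terms \<open>(gh)\<^sup>-\<^sup>1\<close>, \<open>g\<close>, \<open>h\<close> have product one, and so do their images; therefore \<open>\<theta>(gh)\<close> is \<open>\<theta>(g)\<theta>(h)\<close>
or \<open>\<theta>(h)\<theta>(g)\<close>. By a theorem of W. R. Scott (\<open>hom_or_antihom\<close>) such a map is a homomorphism or an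
antihomomorphism, and in the second case \<open>g \<mapsto> \<theta>(g)\<^sup>-\<^sup>1\<close> is an isomorphism. Torsion subgroups with at
most two elements are compared directly: there \<open>\<theta>\<close> need not respect the identity, but it
shows that the cardinalities agree.
\<close>

section \<open>Elements whose radical is prime\<close>

text \<open>In a commutative monoid whose only unit is the identity, the condition says that the radical of
the ideal generated by \<open>a\<close> is a prime ideal. Only multiplication and divisibility enter, so isomorphisms preserve the property.\<close>

definition has_prime_radical :: "('a, 'm) monoid_scheme \<Rightarrow> 'a \<Rightarrow> bool" where
  "has_prime_radical M a \<longleftrightarrow>
     a \<in> carrier M \<and> a \<noteq> \<one>\<^bsub>M\<^esub> \<and>
     (\<forall>s\<in>carrier M. \<forall>t\<in>carrier M. a divides\<^bsub>M\<^esub> s \<otimes>\<^bsub>M\<^esub> t \<longrightarrow>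
        (\<exists>k::nat. a divides\<^bsub>M\<^esub> s [^]\<^bsub>M\<^esub> k \<or> a divides\<^bsub>M\<^esub> t [^]\<^bsub>M\<^esub> k))"

lemma monoid_iso_inv_into:
  assumes "monoid M" "h \<in> iso M N"
  shows "inv_into (carrier M) h \<in> iso N M"
proof -
  interpret M: monoid M by fact
  have hom: "h \<in> hom M N" and bij: "bij_betw h (carrier M) (carrier N)"
    using assms(2) by (auto simp: iso_def)
  let ?k = "inv_into (carrier M) h"
  have k: "?k y \<in> carrier M" "h (?k y) = y" if "y \<in> carrier N" for y
    using bij that bij_betw_inv_into bij_betwE bij_betw_inv_into_right by metis+
  have "?k (x \<otimes>\<^bsub>N\<^esub> y) = ?k x \<otimes>\<^bsub>M\<^esub> ?k y" if "x \<in> carrier N" "y \<in> carrier N" for x y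
  proof -
    have "x \<otimes>\<^bsub>N\<^esub> y = h (?k x \<otimes>\<^bsub>M\<^esub> ?k y)"
      using hom k that by (simp add: hom_mult)
    then show ?thesis
      using bij_betw_inv_into_left[OF bij] k that by simp
  qed
  then show ?thesis
    using bij_betw_inv_into[OF bij] k by (auto simp: iso_def hom_def)
qed

lemma iso_nat_pow:
  assumes "monoid M" "monoid N" "h \<in> iso M N" "x \<in> carrier M"
  shows "h (x [^]\<^bsub>M\<^esub> (k::nat)) = h x [^]\<^bsub>N\<^esub> k"
proof -
  interpret M: monoid M by fact
  interpret N: monoid N by fact
  have "h \<in> hom M N"
    using assms(3) by (simp add: iso_def)
  then show ?thesis
    using assms(4) iso_preserves_one[OF assms(1-3)]
    by (induction k) (simp_all add: hom_mult)
qed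

lemma iso_divides_iff:
  assumes "monoid M" "h \<in> iso M N" "a \<in> carrier M" "b \<in> carrier M"
  shows "h a divides\<^bsub>N\<^esub> h b \<longleftrightarrow> a divides\<^bsub>M\<^esub> b"
proof -
  interpret M: monoid M by fact
  have hom: "h \<in> hom M N" and bij: "bij_betw h (carrier M) (carrier N)"
    using assms(2) by (auto simp: iso_def)
  have "h b = h a \<otimes>\<^bsub>N\<^esub> h c \<longleftrightarrow> b = a \<otimes>\<^bsub>M\<^esub> c" if "c \<in> carrier M" for c
    using that assms(3,4) hom bij_betw_imp_inj_on[OF bij]
    by (metis M.m_closed hom_mult inj_onD)
  then show ?thesis
    unfolding factor_def bij_betw_imp_surj_on[OF bij, symmetric] by simp
qed

lemma iso_has_prime_radical:
  assumes "monoid M" "monoid N" "h \<in> iso M N" "has_prime_radical M a"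
  shows "has_prime_radical N (h a)"
proof -
  interpret M: monoid M by fact
  have hom: "h \<in> hom M N" and bij: "bij_betw h (carrier M) (carrier N)"
    using assms(3) by (auto simp: iso_def)
  have a: "a \<in> carrier M" "a \<noteq> \<one>\<^bsub>M\<^esub>"
    using assms(4) by (auto simp: has_prime_radical_def)
  have "h a \<noteq> \<one>\<^bsub>N\<^esub>"
    using a iso_preserves_one[OF assms(1-3)] bij_betw_imp_inj_on[OF bij]
    by (metis M.one_closed inj_onD)
  moreover have "\<exists>k::nat. h a divides\<^bsub>N\<^esub> h s [^]\<^bsub>N\<^esub> k \<or> h a divides\<^bsub>N\<^esub> h t [^]\<^bsub>N\<^esub> k"
    if st: "s \<in> carrier M" "t \<in> carrier M" and d: "h a divides\<^bsub>N\<^esub> h s \<otimes>\<^bsub>N\<^esub> h t" for s t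
  proof -
    have "a divides\<^bsub>M\<^esub> s \<otimes>\<^bsub>M\<^esub> t"
      using d st a hom iso_divides_iff[OF assms(1,3)] by (simp flip: hom_mult)
    then obtain k :: nat where "a divides\<^bsub>M\<^esub> s [^]\<^bsub>M\<^esub> k \<or> a divides\<^bsub>M\<^esub> t [^]\<^bsub>M\<^esub> k"
      using assms(4) st unfolding has_prime_radical_def by blast
    then show ?thesis
      using a st iso_divides_iff[OF assms(1,3)] by (auto simp flip: iso_nat_pow[OF assms(1-3)])
  qed
  ultimately show ?thesis
    unfolding has_prime_radical_def bij_betw_imp_surj_on[OF bij, symmetric]
    using a by auto
qed

section \<open>Product-one sequences\<close>

lemma product_one_monoid_simps [simp]:
  "S \<otimes>\<^bsub>product_one_monoid G\<^esub> T = S + T"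
  "\<one>\<^bsub>product_one_monoid G\<^esub> = {#}"
  by (simp_all add: product_one_monoid_def sequences_def)

lemma product_one_monoid_pow [simp]:
  "S [^]\<^bsub>product_one_monoid G\<^esub> (k::nat) = repeat_mset k S"
  by (induction k) (simp_all add: add.commute nat_pow_def)

lemma product_one_divides_iff:
  "A divides\<^bsub>product_one_monoid G\<^esub> S \<longleftrightarrow> (\<exists>C\<in>carrier (product_one_monoid G). S = A + C)"
  by (simp add: factor_def)

lemma mem_product_one_monoid_iff:
  "S \<in> carrier (product_one_monoid G) \<longleftrightarrow>
     set_mset S \<subseteq> carrier G \<and> (\<exists>xs. mset xs = S \<and> foldr (\<otimes>\<^bsub>G\<^esub>) xs \<one>\<^bsub>G\<^esub> = \<one>\<^bsub>G\<^esub>)"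
  by (simp add: product_one_monoid_def sequences_def product_one_def set_of_products_def) metis

context group
begin

abbreviation B where "B \<equiv> product_one_monoid G"

lemma monoid_product_one_monoid: "monoid B"
  using submonoid.submonoid_is_monoid[OF submonoid_product_one] comm_monoid.axioms(1)[OF comm_monoid_sequences]
  by (fastforce simp: product_one_monoid_def)

lemma foldr_mult_closed:
  "set xs \<subseteq> carrier G \<Longrightarrow> foldr (\<otimes>) xs \<one> \<in> carrier G"
  by (induction xs) auto

lemma product_oneI:
  "\<lbrakk>set xs \<subseteq> carrier G; foldr (\<otimes>) xs \<one> = \<one>\<rbrakk> \<Longrightarrow> mset xs \<in> carrier B"
  by (auto simp: mem_product_one_monoid_iff)

lemma product_one_terms:
  "\<lbrakk>S \<in> carrier B; x \<in># S\<rbrakk> \<Longrightarrow> x \<in> carrier G"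
  by (auto simp: mem_product_one_monoid_iff)

lemma product_one_add:
  "\<lbrakk>S \<in> carrier B; T \<in> carrier B\<rbrakk> \<Longrightarrow> S + T \<in> carrier B"
  using monoid.m_closed[OF monoid_product_one_monoid] by simp

lemma product_one_empty: "{#} \<in> carrier B"
  using monoid.one_closed[OF monoid_product_one_monoid] by simp

lemma product_one_repeat: "S \<in> carrier B \<Longrightarrow> repeat_mset k S \<in> carrier B"
  using monoid.nat_pow_closed[OF monoid_product_one_monoid, of S k] by simp

lemma foldr_mult_replicate:
  "g \<in> carrier G \<Longrightarrow> foldr (\<otimes>) (replicate k g) \<one> = g [^] k"
  by (induction k) (simp_all flip: nat_pow_Suc2)

lemma product_one_replicate_iff:
  assumes "g \<in> carrier G"
  shows "replicate_mset k g \<in> carrier B \<longleftrightarrow> g [^] k = \<one>"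
proof -
  have eq: "mset xs = replicate_mset k g \<longleftrightarrow> xs = replicate k g" for xs
  proof
    assume eq: "mset xs = replicate_mset k g"
    then have "length xs = k" "\<forall>x\<in>set xs. x = g"
      by (metis size_mset size_replicate_mset) (metis eq in_replicate_mset set_mset_mset)
    then show "xs = replicate k g"
      by (simp add: replicate_eqI)
  qed simp
  have "set_mset (replicate_mset k g) \<subseteq> carrier G"
    using assms by (simp add: set_mset_replicate_mset_subset)
  then show ?thesis
    unfolding mem_product_one_monoid_iff eq using assms
    by (simp add: foldr_mult_replicate del: foldr_replicate)
qed

text \<open>Since \<open>u \<otimes> g \<otimes> v = \<one>\<close> implies \<open>g \<otimes> v \<otimes> u = \<one>\<close>, any chosen term of a product-one sequence
can be placed first.\<close>

lemma product_one_rotate: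
  assumes "add_mset g R \<in> carrier B"
  obtains xs where "mset xs = R" "set xs \<subseteq> carrier G" "g \<otimes> foldr (\<otimes>) xs \<one> = \<one>"
proof -
  obtain ys where ys: "mset ys = add_mset g R" "foldr (\<otimes>) ys \<one> = \<one>" "set ys \<subseteq> carrier G"
    using assms unfolding mem_product_one_monoid_iff
    by (metis set_mset_mset)
  then obtain us vs where split: "ys = us @ g # vs"
    by (metis in_multiset_in_set split_list union_single_eq_member add_mset_add_single)
  show thesis
  proof
    show "mset (vs @ us) = R"
      using ys(1) split by (simp add: add.commute)
    show "set (vs @ us) \<subseteq> carrier G"
      using ys(3) split by auto
    have cl: "set us \<subseteq> carrier G" "set vs \<subseteq> carrier G" "g \<in> carrier G"
      using ys(3) split by auto
    then have "foldr (\<otimes>) us \<one> \<otimes> (g \<otimes> foldr (\<otimes>) vs \<one>) = \<one>"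
      using ys(2,3) split foldr_mult_append[of us "g # vs"] by simp
    then have "g \<otimes> foldr (\<otimes>) vs \<one> \<otimes> foldr (\<otimes>) us \<one> = \<one>"
      using cl by (metis foldr_mult_closed inv_comm m_assoc m_closed)
    then show "g \<otimes> foldr (\<otimes>) (vs @ us) \<one> = \<one>"
      using cl by (simp add: foldr_mult_append m_assoc foldr_mult_closed del: foldr_append)
  qed
qed

lemma product_one_pair:
  assumes "x \<in> carrier G" "y \<in> carrier G"
  shows "{#x, y#} \<in> carrier B \<longleftrightarrow> x \<otimes> y = \<one>"
proof
  assume "{#x, y#} \<in> carrier B"
  then obtain xs where "mset xs = {#y#}" "x \<otimes> foldr (\<otimes>) xs \<one> = \<one>"
    by (rule product_one_rotate)
  then show "x \<otimes> y = \<one>"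
    using assms by simp
next
  assume "x \<otimes> y = \<one>"
  then show "{#x, y#} \<in> carrier B"
    using product_oneI[of "[x, y]"] assms by simp
qed

text \<open>Writing the condition with \<open>inv x\<close> prepares the use of such sequences to read off the products
\<open>y \<otimes> z\<close> and \<open>z \<otimes> y\<close>.\<close>

lemma product_one_triple:
  assumes "x \<in> carrier G" "y \<in> carrier G" "z \<in> carrier G"
  shows "{#x, y, z#} \<in> carrier B \<longleftrightarrow> inv x = y \<otimes> z \<or> inv x = z \<otimes> y"
proof
  assume "{#x, y, z#} \<in> carrier B"
  then obtain xs where xs: "mset xs = {#y, z#}" "x \<otimes> foldr (\<otimes>) xs \<one> = \<one>"
    by (rule product_one_rotate)
  from arg_cong[OF xs(1), of size] obtain u v where "xs = [u, v]"
    by (auto simp: length_Suc_conv)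
  then have "xs = [y, z] \<or> xs = [z, y]"
    using xs(1) by (auto simp: add_eq_conv_ex)
  then show "inv x = y \<otimes> z \<or> inv x = z \<otimes> y"
    using xs(2) assms inv_equality[OF inv_comm] by auto
next
  assume "inv x = y \<otimes> z \<or> inv x = z \<otimes> y"
  then have "x \<otimes> (y \<otimes> z) = \<one> \<or> x \<otimes> (z \<otimes> y) = \<one>"
    using assms(1) r_inv by metis
  then show "{#x, y, z#} \<in> carrier B"
    using product_oneI[of "[x, y, z]"] product_oneI[of "[x, z, y]"] assms
    by (auto simp: add_mset_commute)
qed

lemma repeat_mset_in_product_one:
  assumes "set xs \<subseteq> carrier G" "(foldr (\<otimes>) xs \<one>) [^] (k::nat) = \<one>"
  shows "repeat_mset k (mset xs) \<in> carrier B"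
proof -
  have "foldr (\<otimes>) (concat (replicate k xs)) \<one> = (foldr (\<otimes>) xs \<one>) [^] k \<and>
        mset (concat (replicate k xs)) = repeat_mset k (mset xs)"
  proof (induction k)
    case (Suc k)
    have "set (concat (replicate k xs)) \<subseteq> carrier G"
      using assms(1) by (auto split: if_splits)
    then show ?case
      using assms(1) Suc nat_pow_Suc2[OF foldr_mult_closed[OF assms(1)], of k]
      by (simp add: foldr_mult_append del: foldr_append)
  qed simp
  moreover have "set (concat (replicate k xs)) \<subseteq> carrier G"
    using assms(1) by (auto split: if_splits)
  ultimately show ?thesis
    using product_oneI[of "concat (replicate k xs)"] assms(2) by auto
qed

text \<open>Placing \<open>g\<close> first, the other terms \<open>R\<close> of \<open>S\<close> have an ordering with product \<open>inv g\<close>. So the \<open>k\<close>-fold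
repetition of \<open>R\<close>, which is the complement of \<open>k\<close> copies of \<open>g\<close> in the \<open>k\<close>-fold repetition of \<open>S\<close>, has
product one as well.\<close>

lemma replicate_divides_repeat:
  assumes "S \<in> carrier B" "g \<in># S" "g [^] (k::nat) = \<one>"
  shows "replicate_mset k g divides\<^bsub>B\<^esub> repeat_mset k S"
proof -
  obtain R where S: "S = add_mset g R"
    using assms(2) by (metis multi_member_split)
  have g: "g \<in> carrier G"
    using assms product_one_terms by blast
  obtain xs where xs: "mset xs = R" "set xs \<subseteq> carrier G" "g \<otimes> foldr (\<otimes>) xs \<one> = \<one>"
    using product_one_rotate assms(1) S by metis
  then have "foldr (\<otimes>) xs \<one> = inv g"
    using g by (metis foldr_mult_closed inv_comm inv_equality)
  then have "repeat_mset k R \<in> carrier B"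
    using repeat_mset_in_product_one[OF xs(2), of k] xs(1) g assms(3) by (simp add: nat_pow_inv)
  then show ?thesis
    unfolding product_one_divides_iff S by auto
qed

section \<open>Product-one sequences with prime radical\<close>

lemma has_prime_radical_replicate:
  assumes g: "g \<in> carrier G" "g [^] k = \<one>" and k: "0 < k"
  shows "has_prime_radical B (replicate_mset k g)"
  unfolding has_prime_radical_def
proof (intro conjI ballI impI)
  show "replicate_mset k g \<in> carrier B"
    using g product_one_replicate_iff by simp
  show "replicate_mset k g \<noteq> \<one>\<^bsub>B\<^esub>"
    using k by simp
  fix S T assume S: "S \<in> carrier B" and T: "T \<in> carrier B"
    and d: "replicate_mset k g divides\<^bsub>B\<^esub> S \<otimes>\<^bsub>B\<^esub> T"
  from d obtain C where "S + T = replicate_mset k g + C"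
    by (auto simp: product_one_divides_iff)
  then have "g \<in># S + T"
    using k by simp
  then have "g \<in># S \<or> g \<in># T"
    by simp
  then have "replicate_mset k g divides\<^bsub>B\<^esub> S [^]\<^bsub>B\<^esub> k \<or> replicate_mset k g divides\<^bsub>B\<^esub> T [^]\<^bsub>B\<^esub> k"
    using S T g(2) replicate_divides_repeat by simp blast
  then show "\<exists>k'::nat. replicate_mset k g divides\<^bsub>B\<^esub> S [^]\<^bsub>B\<^esub> k' \<or>
                       replicate_mset k g divides\<^bsub>B\<^esub> T [^]\<^bsub>B\<^esub> k'" ..
qed

text \<open>Repeating a sequence does not add new terms; this turns the algebraic condition into a condition
on sets of terms, which sequences with two different terms are shown to violate.\<close>

lemma prime_radical_separation:
  assumes A: "has_prime_radical B A"
    and S: "S \<in> carrier B" and T: "T \<in> carrier B"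
    and d: "A divides\<^bsub>B\<^esub> (S + T)"
  shows "set_mset A \<subseteq> set_mset S \<or> set_mset A \<subseteq> set_mset T"
proof -
  have "\<exists>k::nat. A divides\<^bsub>B\<^esub> S [^]\<^bsub>B\<^esub> k \<or> A divides\<^bsub>B\<^esub> T [^]\<^bsub>B\<^esub> k"
    using A S T d unfolding has_prime_radical_def product_one_monoid_simps by blast
  then obtain k where "A divides\<^bsub>B\<^esub> repeat_mset k S \<or> A divides\<^bsub>B\<^esub> repeat_mset k T"
    by auto
  moreover have "set_mset A \<subseteq> set_mset U" if dU: "A divides\<^bsub>B\<^esub> repeat_mset k U" for U
  proof -
    obtain C where "repeat_mset k U = A + C"
      using dU by (auto simp: product_one_divides_iff)
    then have "set_mset A \<subseteq> set_mset (repeat_mset k U)"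
      by (metis set_mset_union Un_upper1)
    also have "\<dots> \<subseteq> set_mset U"
      by (auto simp flip: count_greater_zero_iff)
    finally show ?thesis .
  qed
  ultimately show ?thesis
    by blast
qed

lemma product_one_sum:
  "(\<And>x. x \<in># M \<Longrightarrow> f x \<in> carrier B) \<Longrightarrow> (\<Sum>x\<in>#M. f x) \<in> carrier B"
  by (induction M) (auto simp: product_one_empty product_one_add)

text \<open>Every \<open>N\<close>-fold repetition has product one when \<open>N\<close> is the order of the group. So the copies of
\<open>g\<close> and the other terms can be separated inside the \<open>N\<close>-fold repetition of \<open>A\<close>.\<close>

lemma prime_radical_constant_finite:
  assumes fin: "finite (carrier G)" and A: "has_prime_radical B A" and g: "g \<in># A" and h: "h \<in># A"
  shows "h = g"
proof (rule ccontr)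
  assume "h \<noteq> g"
  let ?N = "order G"
  let ?P = "\<lambda>U. (\<Sum>x\<in>#U. replicate_mset ?N x)"
  have AB: "A \<in> carrier B"
    using A by (simp add: has_prime_radical_def)
  have P: "?P U \<in> carrier B" if "set_mset U \<subseteq> set_mset A" for U
  proof (rule product_one_sum)
    show "replicate_mset ?N x \<in> carrier B" if "x \<in># U" for x
      using that \<open>set_mset U \<subseteq> set_mset A\<close> AB product_one_terms
      by (metis pow_order_eq_1 product_one_replicate_iff subsetD)
  qed
  have repeat: "?P U = repeat_mset ?N U" for U
    by (induction U) auto
  have "0 < ?N"
    using fin order_gt_0_iff_finite by blast
  then have "repeat_mset ?N A = A + repeat_mset (?N - 1) A"
    by (metis Suc_pred' repeat_mset_Suc)
  then have "A divides\<^bsub>B\<^esub> repeat_mset ?N A"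
    using product_one_repeat[OF AB] product_one_divides_iff by blast
  also have "repeat_mset ?N A = ?P (filter_mset (\<lambda>x. x = g) A) + ?P (filter_mset (\<lambda>x. x \<noteq> g) A)"
    unfolding repeat by (metis multiset_partition repeat_mset_distrib2)
  finally have "set_mset A \<subseteq> set_mset (?P (filter_mset (\<lambda>x. x = g) A)) \<or>
                set_mset A \<subseteq> set_mset (?P (filter_mset (\<lambda>x. x \<noteq> g) A))"
    by (intro prime_radical_separation[OF A] P) auto
  then show False
    using g h \<open>h \<noteq> g\<close> by (auto simp: subset_iff split: if_splits)
qed

text \<open>Terms of infinite order have no repetition with product one, so each term \<open>a\<close> is instead completed
to \<open>a\<close>, \<open>inv a \<otimes> inv x\<close>, \<open>x\<close>. The product of all completions is divisible by \<open>A\<close>, because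
the added terms taken in reverse order multiply to the inverse of the product of \<open>A\<close>. An infinite
group has room to choose \<open>x\<close> such that no added term occurs in \<open>A\<close>; then the completions of the
copies of \<open>g\<close> avoid \<open>h\<close>, and the completions of the other terms avoid \<open>g\<close>.\<close>

lemma prime_radical_constant_infinite:
  assumes inf: "infinite (carrier G)" and A: "has_prime_radical B A" and g: "g \<in># A" and h: "h \<in># A"
  shows "h = g"
proof (rule ccontr)
  assume "h \<noteq> g"
  have AB: "A \<in> carrier B"
    using A by (simp add: has_prime_radical_def)
  note cl = product_one_terms[OF AB]
  \<comment> \<open>The equation \<open>inv a \<otimes> inv x = b\<close> has the solution \<open>x = inv (a \<otimes> b)\<close>.\<close>
  let ?bad = "set_mset A \<union> (\<lambda>(a, b). inv (a \<otimes> b)) ` (set_mset A \<times> set_mset A)"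
  have "finite ?bad"
    by simp
  then obtain x where x: "x \<in> carrier G" "x \<notin> ?bad"
    using inf by (meson finite_subset subsetI)
  let ?y = "\<lambda>a. inv a \<otimes> inv x"
  have y: "?y a \<noteq> b" if "a \<in># A" "b \<in># A" for a b
  proof
    assume eq: "?y a = b"
    have "a \<in> carrier G"
      using cl that by auto
    then have "a \<otimes> ?y a = inv x"
      using x(1) by (simp flip: m_assoc)
    then have "a \<otimes> b = inv x"
      unfolding eq .
    then have "x = inv (a \<otimes> b)"
      using x(1) by simp
    then show False
      using x(2) that by auto
  qed
  let ?c = "\<lambda>a. {#a, ?y a, x#}"
  have y_x: "?y a \<otimes> x = inv a" if "a \<in># A" for a
    using cl[OF that] x(1) by (simp add: m_assoc)
  have c: "?c a \<in> carrier B" if "a \<in># A" for a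
    using product_oneI[of "[a, ?y a, x]"] cl[OF that] x(1) y_x[OF that] by simp
  have C: "(\<Sum>a\<in>#U. ?c a) \<in> carrier B" if "set_mset U \<subseteq> set_mset A" for U
    using that c by (intro product_one_sum) auto
  have rest: "(\<Sum>a\<in>#A. {#?y a, x#}) \<in> carrier B"
  proof -
    obtain as where as: "mset as = A" "foldr (\<otimes>) as \<one> = \<one>" "set as \<subseteq> carrier G"
      using AB unfolding mem_product_one_monoid_iff by (metis set_mset_mset)
    let ?l = "\<lambda>as. concat (map (\<lambda>a. [?y a, x]) (rev as))"
    have l: "mset (?l as) = (\<Sum>a\<in>#mset as. {#?y a, x#}) \<and> set (?l as) \<subseteq> carrier G \<and>
             foldr (\<otimes>) (?l as) \<one> = inv (foldr (\<otimes>) as \<one>)" if "set as \<subseteq> carrier G" for as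
      using that
    proof (induction as)
      case (Cons a as)
      have "set (?l as) \<subseteq> carrier G" "set [?y a, x] \<subseteq> carrier G"
        using Cons x(1) by auto
      moreover have "?y a \<otimes> x = inv a"
        using Cons.prems x(1) by (simp add: m_assoc)
      ultimately show ?case
        using Cons x(1) by (simp add: foldr_mult_append inv_mult_group foldr_mult_closed del: foldr_append)
    qed simp
    then show ?thesis
      using product_oneI[of "?l as"] l[OF as(3)] as by simp
  qed
  have "(\<Sum>a\<in>#A. ?c a) = A + (\<Sum>a\<in>#A. {#?y a, x#})"
    by (induction A) auto
  then have "A divides\<^bsub>B\<^esub> (\<Sum>a\<in>#A. ?c a)"
    using rest product_one_divides_iff by blast
  also have "(\<Sum>a\<in>#A. ?c a) =
      (\<Sum>a\<in>#filter_mset (\<lambda>a. a = g) A. ?c a) + (\<Sum>a\<in>#filter_mset (\<lambda>a. a \<noteq> g) A. ?c a)"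
    by (subst multiset_partition[of A "\<lambda>a. a = g"]) (simp only: image_mset_union sum_mset.union)
  finally have "set_mset A \<subseteq> set_mset (\<Sum>a\<in>#filter_mset (\<lambda>a. a = g) A. ?c a) \<or>
                set_mset A \<subseteq> set_mset (\<Sum>a\<in>#filter_mset (\<lambda>a. a \<noteq> g) A. ?c a)"
    by (intro prime_radical_separation[OF A] C) auto
  moreover have "h \<notin># (\<Sum>a\<in>#filter_mset (\<lambda>a. a = g) A. ?c a)"
    using g h \<open>h \<noteq> g\<close> y[of _ h] x(2) by auto
  moreover have "g \<notin># (\<Sum>a\<in>#filter_mset (\<lambda>a. a \<noteq> g) A. ?c a)"
    using g y[of _ g] x(2) by auto
  ultimately show False
    using g h by blast
qed

lemma has_prime_radical_iff:
  "has_prime_radical B A \<longleftrightarrow>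
     (\<exists>g\<in>carrier G. \<exists>k>0. g [^] k = \<one> \<and> A = replicate_mset k g)"
proof
  assume A: "has_prime_radical B A"
  then have AB: "A \<in> carrier B" and "A \<noteq> {#}"
    by (auto simp: has_prime_radical_def)
  then obtain g where g: "g \<in># A"
    by blast
  then have "\<forall>h\<in>#A. h = g"
    using A prime_radical_constant_finite prime_radical_constant_infinite by blast
  then have eq: "A = replicate_mset (size A) g"
    by (metis size_mset replicate_eqI ex_mset mset_replicate set_mset_mset)
  moreover have "g \<in> carrier G"
    using AB g product_one_terms by blast
  moreover have "0 < size A"
    using \<open>A \<noteq> {#}\<close> by (simp add: nonempty_has_size)
  ultimately show "\<exists>g\<in>carrier G. \<exists>k>0. g [^] k = \<one> \<and> A = replicate_mset k g"
    using AB by (metis product_one_replicate_iff)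
qed (auto intro: has_prime_radical_replicate)

end

section \<open>Half-homomorphisms\<close>

text \<open>Injective half-homomorphisms in the sense of Scott: the image of a product is the product of the
images in one of the two orders, and the order may depend on the pair.\<close>

locale half_homomorphism = G: group G + H: group H
  for G (structure) and H (structure) +
  fixes f
  assumes closed [simp]: "x \<in> carrier G \<Longrightarrow> f x \<in> carrier H"
    and inj: "inj_on f (carrier G)"
    and half: "\<lbrakk>x \<in> carrier G; y \<in> carrier G\<rbrakk> \<Longrightarrow>
      f (x \<otimes>\<^bsub>G\<^esub> y) = f x \<otimes>\<^bsub>H\<^esub> f y \<or> f (x \<otimes>\<^bsub>G\<^esub> y) = f y \<otimes>\<^bsub>H\<^esub> f x"
begin

text \<open>If the images \<open>A\<close>, \<open>B\<close> of commuting elements \<open>a\<close>, \<open>b\<close> did not commute, say with \<open>ab\<close> mapped to \<open>AB\<close>, then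
the two factorizations of \<open>aab\<close> force its image to be \<open>AAB\<close>. Hence \<open>aabb = (ab)(ab)\<close> is mapped to
\<open>AABB\<close> or \<open>BAAB\<close> on the one hand and to \<open>ABAB\<close> on the other, and both equations give \<open>AB = BA\<close>.\<close>

lemma image_commute:
  assumes a: "a \<in> carrier G" and b: "b \<in> carrier G" and ab: "a \<otimes>\<^bsub>G\<^esub> b = b \<otimes>\<^bsub>G\<^esub> a"
  shows "f a \<otimes>\<^bsub>H\<^esub> f b = f b \<otimes>\<^bsub>H\<^esub> f a"
proof -
  have *: "f a \<otimes>\<^bsub>H\<^esub> f b = f b \<otimes>\<^bsub>H\<^esub> f a"
    if ab: "a \<in> carrier G" "b \<in> carrier G" and fab: "f (a \<otimes>\<^bsub>G\<^esub> b) = f a \<otimes>\<^bsub>H\<^esub> f b"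
      and comm: "a \<otimes>\<^bsub>G\<^esub> b = b \<otimes>\<^bsub>G\<^esub> a" for a b
  proof (rule ccontr)
    let ?A = "f a" and ?B = "f b"
    assume ne: "?A \<otimes>\<^bsub>H\<^esub> ?B \<noteq> ?B \<otimes>\<^bsub>H\<^esub> ?A"
    have "f (a \<otimes>\<^bsub>G\<^esub> a \<otimes>\<^bsub>G\<^esub> b) = ?A \<otimes>\<^bsub>H\<^esub> ?A \<otimes>\<^bsub>H\<^esub> ?B"
    proof -
      have "f (a \<otimes>\<^bsub>G\<^esub> (a \<otimes>\<^bsub>G\<^esub> b)) = ?A \<otimes>\<^bsub>H\<^esub> ?A \<otimes>\<^bsub>H\<^esub> ?B \<or>
            f (a \<otimes>\<^bsub>G\<^esub> (a \<otimes>\<^bsub>G\<^esub> b)) = ?A \<otimes>\<^bsub>H\<^esub> ?B \<otimes>\<^bsub>H\<^esub> ?A"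
        using half[of a "a \<otimes>\<^bsub>G\<^esub> b"] ab fab by (auto simp: H.m_assoc)
      moreover have "f (a \<otimes>\<^bsub>G\<^esub> a) = ?A \<otimes>\<^bsub>H\<^esub> ?A"
        using half[of a a] ab by auto
      then have "f (a \<otimes>\<^bsub>G\<^esub> a \<otimes>\<^bsub>G\<^esub> b) = ?A \<otimes>\<^bsub>H\<^esub> ?A \<otimes>\<^bsub>H\<^esub> ?B \<or>
            f (a \<otimes>\<^bsub>G\<^esub> a \<otimes>\<^bsub>G\<^esub> b) = ?B \<otimes>\<^bsub>H\<^esub> ?A \<otimes>\<^bsub>H\<^esub> ?A"
        using half[of "a \<otimes>\<^bsub>G\<^esub> a" b] ab by (auto simp: H.m_assoc)
      moreover have "?A \<otimes>\<^bsub>H\<^esub> ?B \<otimes>\<^bsub>H\<^esub> ?A \<noteq> ?B \<otimes>\<^bsub>H\<^esub> ?A \<otimes>\<^bsub>H\<^esub> ?A"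
        using ne ab by (subst H.right_cancel) auto
      ultimately show ?thesis
        using ab by (auto simp: G.m_assoc)
    qed
    then have "f (a \<otimes>\<^bsub>G\<^esub> a \<otimes>\<^bsub>G\<^esub> b \<otimes>\<^bsub>G\<^esub> b) = ?A \<otimes>\<^bsub>H\<^esub> ?A \<otimes>\<^bsub>H\<^esub> ?B \<otimes>\<^bsub>H\<^esub> ?B \<or>
               f (a \<otimes>\<^bsub>G\<^esub> a \<otimes>\<^bsub>G\<^esub> b \<otimes>\<^bsub>G\<^esub> b) = ?B \<otimes>\<^bsub>H\<^esub> (?A \<otimes>\<^bsub>H\<^esub> ?A \<otimes>\<^bsub>H\<^esub> ?B)"
      using half[of "a \<otimes>\<^bsub>G\<^esub> a \<otimes>\<^bsub>G\<^esub> b" b] ab by auto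
    moreover have "a \<otimes>\<^bsub>G\<^esub> a \<otimes>\<^bsub>G\<^esub> b \<otimes>\<^bsub>G\<^esub> b = (a \<otimes>\<^bsub>G\<^esub> b) \<otimes>\<^bsub>G\<^esub> (a \<otimes>\<^bsub>G\<^esub> b)"
      using ab comm by (metis G.m_assoc G.m_closed)
    moreover have "f ((a \<otimes>\<^bsub>G\<^esub> b) \<otimes>\<^bsub>G\<^esub> (a \<otimes>\<^bsub>G\<^esub> b)) = ?A \<otimes>\<^bsub>H\<^esub> ?B \<otimes>\<^bsub>H\<^esub> (?A \<otimes>\<^bsub>H\<^esub> ?B)"
      using half[of "a \<otimes>\<^bsub>G\<^esub> b" "a \<otimes>\<^bsub>G\<^esub> b"] ab fab by auto
    moreover have "?A \<otimes>\<^bsub>H\<^esub> ?B \<otimes>\<^bsub>H\<^esub> (?A \<otimes>\<^bsub>H\<^esub> ?B) \<noteq> ?B \<otimes>\<^bsub>H\<^esub> (?A \<otimes>\<^bsub>H\<^esub> ?A \<otimes>\<^bsub>H\<^esub> ?B)"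
    proof -
      have "?B \<otimes>\<^bsub>H\<^esub> (?A \<otimes>\<^bsub>H\<^esub> ?A \<otimes>\<^bsub>H\<^esub> ?B) = ?B \<otimes>\<^bsub>H\<^esub> ?A \<otimes>\<^bsub>H\<^esub> (?A \<otimes>\<^bsub>H\<^esub> ?B)"
        using ab by (simp add: H.m_assoc)
      then show ?thesis
        using ne ab by (simp only: H.right_cancel H.m_closed closed) simp
    qed
    moreover have "?A \<otimes>\<^bsub>H\<^esub> ?B \<otimes>\<^bsub>H\<^esub> (?A \<otimes>\<^bsub>H\<^esub> ?B) \<noteq> ?A \<otimes>\<^bsub>H\<^esub> ?A \<otimes>\<^bsub>H\<^esub> ?B \<otimes>\<^bsub>H\<^esub> ?B"
    proof -
      have "?A \<otimes>\<^bsub>H\<^esub> ?B \<otimes>\<^bsub>H\<^esub> (?A \<otimes>\<^bsub>H\<^esub> ?B) = ?A \<otimes>\<^bsub>H\<^esub> (?B \<otimes>\<^bsub>H\<^esub> ?A) \<otimes>\<^bsub>H\<^esub> ?B"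
           "?A \<otimes>\<^bsub>H\<^esub> ?A \<otimes>\<^bsub>H\<^esub> ?B \<otimes>\<^bsub>H\<^esub> ?B = ?A \<otimes>\<^bsub>H\<^esub> (?A \<otimes>\<^bsub>H\<^esub> ?B) \<otimes>\<^bsub>H\<^esub> ?B"
        using ab by (simp_all add: H.m_assoc)
      then show ?thesis
        using ne ab by simp
    qed
    ultimately show False
      by metis
  qed
  from half[OF a b] show ?thesis
    using * a b ab by metis
qed

lemma image_of_swapped_product:
  assumes "a \<in> carrier G" "b \<in> carrier G" "f (a \<otimes>\<^bsub>G\<^esub> b) = f a \<otimes>\<^bsub>H\<^esub> f b"
  shows "f (b \<otimes>\<^bsub>G\<^esub> a) = f b \<otimes>\<^bsub>H\<^esub> f a"
proof (cases "a \<otimes>\<^bsub>G\<^esub> b = b \<otimes>\<^bsub>G\<^esub> a")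
  case True
  then show ?thesis
    using assms image_commute by metis
next
  case False
  then have "f (b \<otimes>\<^bsub>G\<^esub> a) \<noteq> f (a \<otimes>\<^bsub>G\<^esub> b)"
    using assms inj by (metis G.m_closed inj_onD)
  then show ?thesis
    using half[of b a] assms by auto
qed

text \<open>Suppose that \<open>ab\<close> is mapped to \<open>AB \<noteq> BA\<close> and \<open>ac\<close> to \<open>CA \<noteq> AC\<close>. The two factorizations of \<open>bac\<close>
show that \<open>BC = CB\<close> or \<open>CAB = BAC\<close>. With \<open>c = bd\<close>, the two factorizations of \<open>ac = (ab)d\<close>
show that either \<open>C = BD\<close> and \<open>BDA = DAB\<close>, or \<open>C = DB\<close> and \<open>DBA = ABD\<close>. Each of the four
combinations makes \<open>A\<close> commute with \<open>B\<close> or with \<open>C\<close>.\<close>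

lemma preserves_or_reverses_at:
  assumes a: "a \<in> carrier G"
  shows "(\<forall>x\<in>carrier G. f (a \<otimes>\<^bsub>G\<^esub> x) = f a \<otimes>\<^bsub>H\<^esub> f x) \<or>
         (\<forall>x\<in>carrier G. f (a \<otimes>\<^bsub>G\<^esub> x) = f x \<otimes>\<^bsub>H\<^esub> f a)"
proof (rule ccontr)
  assume "\<not> ?thesis"
  then obtain b c where bc: "b \<in> carrier G" "c \<in> carrier G"
    and nb: "f (a \<otimes>\<^bsub>G\<^esub> b) \<noteq> f b \<otimes>\<^bsub>H\<^esub> f a" and nc: "f (a \<otimes>\<^bsub>G\<^esub> c) \<noteq> f a \<otimes>\<^bsub>H\<^esub> f c"
    by blast
  define d where "d = inv\<^bsub>G\<^esub> b \<otimes>\<^bsub>G\<^esub> c"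
  let ?A = "f a" and ?B = "f b" and ?C = "f c" and ?D = "f d"
  have d: "d \<in> carrier G" "b \<otimes>\<^bsub>G\<^esub> d = c"
    using bc by (auto simp: d_def simp flip: G.m_assoc)
  note cl [simp] = a bc d(1)
  have fab: "f (a \<otimes>\<^bsub>G\<^esub> b) = ?A \<otimes>\<^bsub>H\<^esub> ?B" and fac: "f (a \<otimes>\<^bsub>G\<^esub> c) = ?C \<otimes>\<^bsub>H\<^esub> ?A"
    using half[of a b] half[of a c] nb nc by auto
  have neB: "?A \<otimes>\<^bsub>H\<^esub> ?B \<noteq> ?B \<otimes>\<^bsub>H\<^esub> ?A" and neC: "?A \<otimes>\<^bsub>H\<^esub> ?C \<noteq> ?C \<otimes>\<^bsub>H\<^esub> ?A"
    using fab fac nb nc by auto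
  have fba: "f (b \<otimes>\<^bsub>G\<^esub> a) = ?B \<otimes>\<^bsub>H\<^esub> ?A"
    using image_of_swapped_product fab by simp
  have "a \<otimes>\<^bsub>G\<^esub> c = a \<otimes>\<^bsub>G\<^esub> b \<otimes>\<^bsub>G\<^esub> d"
    by (simp add: G.m_assoc flip: d(2))
  then have ac: "?C \<otimes>\<^bsub>H\<^esub> ?A = ?A \<otimes>\<^bsub>H\<^esub> ?B \<otimes>\<^bsub>H\<^esub> ?D \<or> ?C \<otimes>\<^bsub>H\<^esub> ?A = ?D \<otimes>\<^bsub>H\<^esub> (?A \<otimes>\<^bsub>H\<^esub> ?B)"
    using half[of "a \<otimes>\<^bsub>G\<^esub> b" d] fab fac by auto
  have C: "?C = ?B \<otimes>\<^bsub>H\<^esub> ?D \<or> ?C = ?D \<otimes>\<^bsub>H\<^esub> ?B"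
    using half[of b d] d by auto
  have bac: "?B \<otimes>\<^bsub>H\<^esub> ?C = ?C \<otimes>\<^bsub>H\<^esub> ?B \<or> ?C \<otimes>\<^bsub>H\<^esub> ?A \<otimes>\<^bsub>H\<^esub> ?B = ?B \<otimes>\<^bsub>H\<^esub> ?A \<otimes>\<^bsub>H\<^esub> ?C"
  proof -
    have "f (b \<otimes>\<^bsub>G\<^esub> a \<otimes>\<^bsub>G\<^esub> c) = ?B \<otimes>\<^bsub>H\<^esub> (?C \<otimes>\<^bsub>H\<^esub> ?A) \<or> f (b \<otimes>\<^bsub>G\<^esub> a \<otimes>\<^bsub>G\<^esub> c) = ?C \<otimes>\<^bsub>H\<^esub> ?A \<otimes>\<^bsub>H\<^esub> ?B"
      using half[of b "a \<otimes>\<^bsub>G\<^esub> c"] fac by (simp add: G.m_assoc)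
    moreover have "f (b \<otimes>\<^bsub>G\<^esub> a \<otimes>\<^bsub>G\<^esub> c) = ?B \<otimes>\<^bsub>H\<^esub> ?A \<otimes>\<^bsub>H\<^esub> ?C \<or> f (b \<otimes>\<^bsub>G\<^esub> a \<otimes>\<^bsub>G\<^esub> c) = ?C \<otimes>\<^bsub>H\<^esub> (?B \<otimes>\<^bsub>H\<^esub> ?A)"
      using half[of "b \<otimes>\<^bsub>G\<^esub> a" c] fba by simp
    moreover have "?B \<otimes>\<^bsub>H\<^esub> (?C \<otimes>\<^bsub>H\<^esub> ?A) \<noteq> ?B \<otimes>\<^bsub>H\<^esub> ?A \<otimes>\<^bsub>H\<^esub> ?C"
      using neC by (simp add: H.m_assoc)
    moreover have "?C \<otimes>\<^bsub>H\<^esub> ?A \<otimes>\<^bsub>H\<^esub> ?B \<noteq> ?C \<otimes>\<^bsub>H\<^esub> (?B \<otimes>\<^bsub>H\<^esub> ?A)"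
      using neB by (simp add: H.m_assoc)
    moreover have "?B \<otimes>\<^bsub>H\<^esub> ?C = ?C \<otimes>\<^bsub>H\<^esub> ?B" if "?B \<otimes>\<^bsub>H\<^esub> (?C \<otimes>\<^bsub>H\<^esub> ?A) = ?C \<otimes>\<^bsub>H\<^esub> (?B \<otimes>\<^bsub>H\<^esub> ?A)"
      using that by (simp flip: H.m_assoc)
    ultimately show ?thesis
      by metis
  qed
  from C show False
  proof
    assume C: "?C = ?B \<otimes>\<^bsub>H\<^esub> ?D"
    have BDA: "?B \<otimes>\<^bsub>H\<^esub> ?D \<otimes>\<^bsub>H\<^esub> ?A = ?D \<otimes>\<^bsub>H\<^esub> ?A \<otimes>\<^bsub>H\<^esub> ?B"
      using ac neC unfolding C by (auto simp: H.m_assoc)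
    from bac show False
    proof
      assume "?B \<otimes>\<^bsub>H\<^esub> ?C = ?C \<otimes>\<^bsub>H\<^esub> ?B"
      then have "?B \<otimes>\<^bsub>H\<^esub> ?D = ?D \<otimes>\<^bsub>H\<^esub> ?B"
        unfolding C by (simp add: H.m_assoc)
      then show False
        using BDA neB by (simp add: H.m_assoc)
    next
      assume "?C \<otimes>\<^bsub>H\<^esub> ?A \<otimes>\<^bsub>H\<^esub> ?B = ?B \<otimes>\<^bsub>H\<^esub> ?A \<otimes>\<^bsub>H\<^esub> ?C"
      then have "?D \<otimes>\<^bsub>H\<^esub> ?A \<otimes>\<^bsub>H\<^esub> ?B = ?A \<otimes>\<^bsub>H\<^esub> ?B \<otimes>\<^bsub>H\<^esub> ?D"
        unfolding C by (simp add: H.m_assoc)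
      then show False
        using BDA neC unfolding C by (simp add: H.m_assoc)
    qed
  next
    assume C: "?C = ?D \<otimes>\<^bsub>H\<^esub> ?B"
    have DBA: "?D \<otimes>\<^bsub>H\<^esub> ?B \<otimes>\<^bsub>H\<^esub> ?A = ?A \<otimes>\<^bsub>H\<^esub> ?B \<otimes>\<^bsub>H\<^esub> ?D"
      using ac neB unfolding C by (auto simp: H.m_assoc)
    from bac show False
    proof
      assume "?B \<otimes>\<^bsub>H\<^esub> ?C = ?C \<otimes>\<^bsub>H\<^esub> ?B"
      then have "?B \<otimes>\<^bsub>H\<^esub> ?D = ?D \<otimes>\<^bsub>H\<^esub> ?B"
        unfolding C by (simp flip: H.m_assoc)
      then show False
        using DBA neC unfolding C by (simp add: H.m_assoc)
    next
      assume "?C \<otimes>\<^bsub>H\<^esub> ?A \<otimes>\<^bsub>H\<^esub> ?B = ?B \<otimes>\<^bsub>H\<^esub> ?A \<otimes>\<^bsub>H\<^esub> ?C"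
      then have "?A \<otimes>\<^bsub>H\<^esub> ?B \<otimes>\<^bsub>H\<^esub> (?D \<otimes>\<^bsub>H\<^esub> ?B) = ?B \<otimes>\<^bsub>H\<^esub> ?A \<otimes>\<^bsub>H\<^esub> (?D \<otimes>\<^bsub>H\<^esub> ?B)"
        unfolding C using DBA by (simp add: H.m_assoc)
      then show False
        using neB by simp
    qed
  qed
qed

text \<open>Suppose that the products \<open>ax\<close> and \<open>by\<close> witness the failure of both alternatives. By the dichotomy at
each element, all products \<open>az\<close> are then reversed and all products \<open>bz\<close> are preserved, so \<open>abz\<close> is
mapped to \<open>BZA\<close>. The dichotomy at \<open>ab\<close>, which is mapped to \<open>BA\<close>, makes this equal to \<open>BAZ\<close> for all \<open>z\<close>
or to \<open>ZBA\<close> for all \<open>z\<close>. So \<open>ax\<close> is preserved or \<open>by\<close> is reversed after all.\<close>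

lemma hom_or_antihom:
  "(\<forall>x\<in>carrier G. \<forall>y\<in>carrier G. f (x \<otimes>\<^bsub>G\<^esub> y) = f x \<otimes>\<^bsub>H\<^esub> f y) \<or>
   (\<forall>x\<in>carrier G. \<forall>y\<in>carrier G. f (x \<otimes>\<^bsub>G\<^esub> y) = f y \<otimes>\<^bsub>H\<^esub> f x)"
proof (rule ccontr)
  assume "\<not> ?thesis"
  then obtain a x b y where cl [simp]: "a \<in> carrier G" "x \<in> carrier G" "b \<in> carrier G" "y \<in> carrier G"
    and nx: "f (a \<otimes>\<^bsub>G\<^esub> x) \<noteq> f a \<otimes>\<^bsub>H\<^esub> f x" and ny: "f (b \<otimes>\<^bsub>G\<^esub> y) \<noteq> f y \<otimes>\<^bsub>H\<^esub> f b"
    by blast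
  have a: "f (a \<otimes>\<^bsub>G\<^esub> z) = f z \<otimes>\<^bsub>H\<^esub> f a" if "z \<in> carrier G" for z
    using preserves_or_reverses_at[OF cl(1)] nx that by auto
  have b: "f (b \<otimes>\<^bsub>G\<^esub> z) = f b \<otimes>\<^bsub>H\<^esub> f z" if "z \<in> carrier G" for z
    using preserves_or_reverses_at[OF cl(3)] ny that by auto
  have abz: "f (a \<otimes>\<^bsub>G\<^esub> b \<otimes>\<^bsub>G\<^esub> z) = f b \<otimes>\<^bsub>H\<^esub> f z \<otimes>\<^bsub>H\<^esub> f a" if "z \<in> carrier G" for z
    using that by (simp add: G.m_assoc a b)
  have "f (a \<otimes>\<^bsub>G\<^esub> b \<otimes>\<^bsub>G\<^esub> x) = f b \<otimes>\<^bsub>H\<^esub> f a \<otimes>\<^bsub>H\<^esub> f x \<or>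
        f (a \<otimes>\<^bsub>G\<^esub> b \<otimes>\<^bsub>G\<^esub> y) = f y \<otimes>\<^bsub>H\<^esub> (f b \<otimes>\<^bsub>H\<^esub> f a)"
    using preserves_or_reverses_at[of "a \<otimes>\<^bsub>G\<^esub> b"] by (auto simp: a)
  then show False
  proof
    assume "f (a \<otimes>\<^bsub>G\<^esub> b \<otimes>\<^bsub>G\<^esub> x) = f b \<otimes>\<^bsub>H\<^esub> f a \<otimes>\<^bsub>H\<^esub> f x"
    then have "f x \<otimes>\<^bsub>H\<^esub> f a = f a \<otimes>\<^bsub>H\<^esub> f x"
      using abz[of x] by (simp add: H.m_assoc)
    then show False
      using nx a by simp
  next
    assume "f (a \<otimes>\<^bsub>G\<^esub> b \<otimes>\<^bsub>G\<^esub> y) = f y \<otimes>\<^bsub>H\<^esub> (f b \<otimes>\<^bsub>H\<^esub> f a)"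
    then have "f b \<otimes>\<^bsub>H\<^esub> f y = f y \<otimes>\<^bsub>H\<^esub> f b"
      using abz[of y] by (simp flip: H.m_assoc)
    then show False
      using ny b by simp
  qed
qed

lemma bij_imp_is_iso:
  assumes bij: "bij_betw f (carrier G) (carrier H)"
  shows "G \<cong> H"
  using hom_or_antihom
proof
  assume "\<forall>x\<in>carrier G. \<forall>y\<in>carrier G. f (x \<otimes>\<^bsub>G\<^esub> y) = f x \<otimes>\<^bsub>H\<^esub> f y"
  then have "f \<in> iso G H"
    using bij by (auto simp: iso_def hom_def)
  then show ?thesis
    by (auto simp: is_iso_def)
next
  assume "\<forall>x\<in>carrier G. \<forall>y\<in>carrier G. f (x \<otimes>\<^bsub>G\<^esub> y) = f y \<otimes>\<^bsub>H\<^esub> f x"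
  then have "(\<lambda>x. inv\<^bsub>H\<^esub> (f x)) \<in> hom G H"
    by (auto simp: hom_def H.inv_mult_group)
  moreover have "bij_betw (\<lambda>x. inv\<^bsub>H\<^esub> x) (carrier H) (carrier H)"
    by (rule bij_betw_byWitness[where f' = "\<lambda>x. inv\<^bsub>H\<^esub> x"]) auto
  then have "bij_betw (\<lambda>x. inv\<^bsub>H\<^esub> (f x)) (carrier G) (carrier H)"
    using bij_betw_trans[OF bij] by (simp add: comp_def)
  ultimately show ?thesis
    by (auto simp: is_iso_def iso_def)
qed

end

section \<open>Torsion terms\<close>

lemma repeat_mset_replicate_mset_mult:
  "repeat_mset m (replicate_mset n x) = replicate_mset (m * n) x"
  by (rule multiset_eqI) simp

lemma (in group) ord_pos_if_torsion:
  "g \<in> torsion_elements G \<Longrightarrow> 0 < ord g"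
  by (simp add: torsion_elements_iff_ord)

lemma torsion_elements_carrier [simp]: "g \<in> torsion_elements G \<Longrightarrow> g \<in> carrier G"
  by (simp add: torsion_elements_def)

text \<open>The shortest product-one sequence whose only term is \<open>g\<close>. For \<open>g\<close> of infinite order \<open>ord g = 0\<close>, and
the block is the empty sequence.\<close>

definition (in group) torsion_block where
  "torsion_block g = replicate_mset (ord g) g"

lemma (in group) torsion_block_in_B [simp]:
  "g \<in> carrier G \<Longrightarrow> torsion_block g \<in> carrier B"
  by (simp add: torsion_block_def product_one_replicate_iff)

lemma (in group) set_mset_torsion_block:
  "g \<in> torsion_elements G \<Longrightarrow> set_mset (torsion_block g) = {g}"
  using ord_pos_if_torsion by (simp add: torsion_block_def)

text \<open>The blocks are singled out among all sequences with prime radical as those which are not proper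
powers; this is how \<open>map_block\<close> below recognises them.\<close>

lemma (in group) has_prime_radical_iff_power_of_block:
  "has_prime_radical B A \<longleftrightarrow>
     (\<exists>g\<in>torsion_elements G. \<exists>m>0. A = repeat_mset m (torsion_block g))"
proof
  assume "has_prime_radical B A"
  then obtain g k where g: "g \<in> carrier G" "0 < k" "g [^] k = \<one>" "A = replicate_mset k g"
    by (auto simp: has_prime_radical_iff)
  then obtain m where "k = ord g * m"
    using pow_eq_id by (meson dvdE)
  with g have "g \<in> torsion_elements G" "0 < m" "A = repeat_mset m (torsion_block g)"
    by (simp_all add: torsion_block_def torsion_elements_iff_ord repeat_mset_replicate_mset_mult mult.commute)
  then show "\<exists>g\<in>torsion_elements G. \<exists>m>0. A = repeat_mset m (torsion_block g)"
    by blast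
next
  assume "\<exists>g\<in>torsion_elements G. \<exists>m>0. A = repeat_mset m (torsion_block g)"
  then obtain g m where g: "g \<in> torsion_elements G" "0 < m" "A = repeat_mset m (torsion_block g)"
    by blast
  then have "A = replicate_mset (m * ord g) g" "g [^] (m * ord g) = \<one>" "0 < m * ord g"
    using ord_pos_if_torsion pow_eq_id
    by (auto simp: torsion_block_def repeat_mset_replicate_mset_mult)
  then show "has_prime_radical B A"
    using g(1) has_prime_radical_replicate by simp
qed

text \<open>If \<open>g\<close> is not its own inverse, then \<open>inv g\<close> completes it. Otherwise a third torsion element \<open>h\<close> is
used, with the completion \<open>h\<close>, \<open>inv (g \<otimes> h)\<close>. For a group of order two and \<open>g \<noteq> \<one>\<close>, the number
of copies of \<open>g\<close> in a product-one sequence is always even.\<close>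

lemma (in group) ex_product_one_with_simple_term:
  assumes sub: "subgroup (torsion_elements G) G" and g: "g \<in> torsion_elements G"
    and large: "\<not> torsion_elements G \<subseteq> {\<one>, g}"
  obtains R where "add_mset g R \<in> carrier B" "set_mset R \<subseteq> torsion_elements G" "g \<notin># R"
proof (cases "inv g = g")
  case False
  then show thesis
    using that[of "{#inv g#}"] g subgroup.m_inv_closed[OF sub g]
    by (auto simp: product_one_pair)
next
  case True
  then have gg: "g \<otimes> g = \<one>"
    using g by (metis r_inv torsion_elements_carrier)
  obtain h where h: "h \<in> torsion_elements G" "h \<noteq> \<one>" "h \<noteq> g"
    using large by blast
  have gh: "g \<otimes> h \<in> torsion_elements G"
    using subgroup.m_closed[OF sub g h(1)] .
  show thesis
  proof (rule that[of "{#h, inv (g \<otimes> h)#}"])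
    have "{#inv (g \<otimes> h), g, h#} \<in> carrier B"
      using g h gh by (subst product_one_triple) auto
    then show "{#g, h, inv (g \<otimes> h)#} \<in> carrier B"
      by (simp add: add_mset_commute)
    show "set_mset {#h, inv (g \<otimes> h)#} \<subseteq> torsion_elements G"
      using h subgroup.m_inv_closed[OF sub gh] by simp
    have "inv (g \<otimes> h) \<noteq> g"
    proof
      assume "inv (g \<otimes> h) = g"
      then have "g \<otimes> h = g"
        using g gh True by (metis inv_inv torsion_elements_carrier)
      then show False
        using g h by simp
    qed
    then show "g \<notin># {#h, inv (g \<otimes> h)#}"
      using h by auto
  qed
qed

lemma (in group) ex_common_exponent:
  assumes "set_mset S \<subseteq> torsion_elements G"
  obtains N where "0 < N" "\<forall>x\<in>#S. ord x dvd N"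
proof
  show "0 < (\<Prod>x\<in>set_mset S. ord x)"
    using assms ord_pos_if_torsion by (intro prod_pos) auto
  show "\<forall>x\<in>#S. ord x dvd (\<Prod>x\<in>set_mset S. ord x)"
    by (auto intro: dvd_prodI)
qed

section \<open>Isomorphisms between monoids of product-one sequences\<close>

locale product_one_iso = G: group G + H: group H
  for G (structure) and H (structure) +
  fixes \<phi>
  assumes iso: "\<phi> \<in> iso (product_one_monoid G) (product_one_monoid H)"
begin

lemma inverse: "product_one_iso H G (inv_into (carrier G.B) \<phi>)"
  using monoid_iso_inv_into[OF G.monoid_product_one_monoid iso]
  by unfold_locales

lemma bij: "bij_betw \<phi> (carrier G.B) (carrier H.B)"
  using iso by (simp add: iso_def)

lemma map_closed: "S \<in> carrier G.B \<Longrightarrow> \<phi> S \<in> carrier H.B"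
  using bij bij_betwE by blast

lemma map_add: "\<lbrakk>S \<in> carrier G.B; T \<in> carrier G.B\<rbrakk> \<Longrightarrow> \<phi> (S + T) = \<phi> S + \<phi> T"
  using iso hom_mult[of \<phi> G.B H.B S T] by (simp add: iso_def)

lemma map_empty: "\<phi> {#} = {#}"
  using iso_preserves_one[OF G.monoid_product_one_monoid H.monoid_product_one_monoid iso] by simp

lemma map_repeat: "S \<in> carrier G.B \<Longrightarrow> \<phi> (repeat_mset k S) = repeat_mset k (\<phi> S)"
  using iso_nat_pow[OF G.monoid_product_one_monoid H.monoid_product_one_monoid iso, of S k] by simp

lemma map_inj: "\<lbrakk>\<phi> S = \<phi> T; S \<in> carrier G.B; T \<in> carrier G.B\<rbrakk> \<Longrightarrow> S = T"
  using bij bij_betw_imp_inj_on inj_onD by metis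

lemma map_block_power:
  assumes "g \<in> torsion_elements G"
  obtains h m where "h \<in> torsion_elements H" "0 < m"
    "\<phi> (G.torsion_block g) = repeat_mset m (H.torsion_block h)"
proof -
  have "\<exists>m>0. G.torsion_block g = repeat_mset m (G.torsion_block g)"
    by (rule exI[of _ 1]) simp
  then have "has_prime_radical G.B (G.torsion_block g)"
    using assms G.has_prime_radical_iff_power_of_block by blast
  then have "has_prime_radical H.B (\<phi> (G.torsion_block g))"
    using iso_has_prime_radical[OF G.monoid_product_one_monoid H.monoid_product_one_monoid iso] by simp
  then show thesis
    using H.has_prime_radical_iff_power_of_block that by blast
qed

text \<open>The image of a block is an \<open>m\<close>-th power of a block. Applying the inverse isomorphism exhibits the
original block as an \<open>m\<close>-th power of a product-one sequence in one term, and minimality of the order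
gives \<open>m = 1\<close>.\<close>

lemma map_block:
  assumes g: "g \<in> torsion_elements G"
  shows "\<exists>h\<in>torsion_elements H. \<phi> (G.torsion_block g) = H.torsion_block h"
proof -
  let ?\<psi> = "inv_into (carrier G.B) \<phi>"
  interpret inv: product_one_iso H G ?\<psi>
    by (rule inverse)
  obtain h m where h: "h \<in> torsion_elements H" "0 < m"
      "\<phi> (G.torsion_block g) = repeat_mset m (H.torsion_block h)"
    using map_block_power g by blast
  obtain g' m' where g': "g' \<in> torsion_elements G" "0 < m'"
      "?\<psi> (H.torsion_block h) = repeat_mset m' (G.torsion_block g')"
    using inv.map_block_power h(1) by blast
  have "G.torsion_block g = ?\<psi> (\<phi> (G.torsion_block g))"
    using bij_betw_inv_into_left[OF bij] g by simp
  also have "\<dots> = repeat_mset (m * m') (G.torsion_block g')"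
    using h g' inv.map_repeat by simp
  finally have eq: "G.torsion_block g = repeat_mset (m * m') (G.torsion_block g')" .
  then have "g \<in># repeat_mset (m * m') (G.torsion_block g')"
    using G.set_mset_torsion_block[OF g] by auto
  then have "g \<in># G.torsion_block g'"
    by (simp flip: count_greater_zero_iff)
  then have "g' = g"
    using G.set_mset_torsion_block[OF g'(1)] by simp
  have "size (G.torsion_block g) = m * m' * size (G.torsion_block g)"
    using arg_cong[OF eq, of size] \<open>g' = g\<close> by simp
  then have "m = 1"
    using G.ord_pos_if_torsion[OF g] by (simp add: G.torsion_block_def)
  then show ?thesis
    using h by auto
qed

definition term_map where
  "term_map g = (SOME h. h \<in> torsion_elements H \<and> \<phi> (G.torsion_block g) = H.torsion_block h)"

lemma term_map:
  assumes "g \<in> torsion_elements G"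
  shows "term_map g \<in> torsion_elements H" "\<phi> (G.torsion_block g) = H.torsion_block (term_map g)"
  using someI_ex[of "\<lambda>h. h \<in> torsion_elements H \<and> \<phi> (G.torsion_block g) = H.torsion_block h"]
    map_block[OF assms] by (auto simp: term_map_def)

lemma term_map_eqI:
  assumes "g \<in> torsion_elements G" "h \<in> torsion_elements H" "\<phi> (G.torsion_block g) = H.torsion_block h"
  shows "term_map g = h"
  using assms term_map[OF assms(1)] H.set_mset_torsion_block by (metis singleton_inject)

lemma term_map_bij: "bij_betw term_map (torsion_elements G) (torsion_elements H)"
proof (rule bij_betw_imageI)
  let ?\<psi> = "inv_into (carrier G.B) \<phi>"
  interpret inv: product_one_iso H G ?\<psi>
    by (rule inverse)
  show "inj_on term_map (torsion_elements G)"
  proof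
    fix x y assume x: "x \<in> torsion_elements G" and y: "y \<in> torsion_elements G"
      and eq: "term_map x = term_map y"
    then have "G.torsion_block x = G.torsion_block y"
      using term_map(2) by (intro map_inj) auto
    then show "x = y"
      using x y G.set_mset_torsion_block by (metis singleton_inject)
  qed
  have "h \<in> term_map ` torsion_elements G" if h: "h \<in> torsion_elements H" for h
  proof -
    obtain g where g: "g \<in> torsion_elements G" "?\<psi> (H.torsion_block h) = G.torsion_block g"
      using inv.map_block h by blast
    then have "\<phi> (G.torsion_block g) = H.torsion_block h"
      using bij_betw_inv_into_right[OF bij, of "H.torsion_block h"] h by simp
    then show ?thesis
      using term_map_eqI g h by blast
  qed
  then show "term_map ` torsion_elements G = torsion_elements H"
    using term_map(1) by auto
qed

text \<open>When the orders of all terms divide \<open>N\<close>, the \<open>N\<close>-fold repetition of \<open>S\<close> is a sum of powers of blocks,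
so its image is known.\<close>

lemma map_multiple:
  assumes "set_mset S \<subseteq> torsion_elements G" "\<forall>x\<in>#S. G.ord x dvd N"
  shows "repeat_mset N S \<in> carrier G.B \<and>
    \<phi> (repeat_mset N S) =
      (\<Sum>x\<in>#S. replicate_mset (N div G.ord x * H.ord (term_map x)) (term_map x))"
  using assms
proof (induction S)
  case empty
  then show ?case
    by (simp add: map_empty G.product_one_empty)
next
  case (add x S)
  have x: "x \<in> torsion_elements G" "G.ord x dvd N"
    using add.prems by auto
  then have x_eq: "replicate_mset N x = repeat_mset (N div G.ord x) (G.torsion_block x)"
    by (simp add: G.torsion_block_def repeat_mset_replicate_mset_mult)
  have "replicate_mset N x \<in> carrier G.B"
    unfolding x_eq using x by (intro G.product_one_repeat) simp
  moreover have "\<phi> (replicate_mset N x) =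
      replicate_mset (N div G.ord x * H.ord (term_map x)) (term_map x)"
    unfolding x_eq using x
    by (simp add: map_repeat term_map(2) H.torsion_block_def repeat_mset_replicate_mset_mult)
  ultimately show ?case
    using add by (simp add: map_add G.product_one_add)
qed

text \<open>Let \<open>S\<close> contain \<open>g\<close> exactly once. In \<open>\<phi> S\<close>, the multiplicity of \<open>term_map g\<close> is the quotient of the
order of \<open>term_map g\<close> by the order of \<open>g\<close>, and a multiplicity is an integer.\<close>

lemma ord_dvd_ord_term_map:
  assumes sub: "subgroup (torsion_elements G) G" and g: "g \<in> torsion_elements G"
    and large: "\<not> torsion_elements G \<subseteq> {\<one>, g}"
  shows "G.ord g dvd H.ord (term_map g)"
proof -
  obtain R where R: "add_mset g R \<in> carrier G.B" "set_mset R \<subseteq> torsion_elements G" "g \<notin># R"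
    using G.ex_product_one_with_simple_term[OF sub g large] .
  then have S: "set_mset (add_mset g R) \<subseteq> torsion_elements G"
    using g by simp
  obtain N where N: "0 < N" "\<forall>x\<in>#add_mset g R. G.ord x dvd N"
    using G.ex_common_exponent[OF S] .
  have "repeat_mset N (\<phi> (add_mset g R)) =
      (\<Sum>x\<in>#add_mset g R. replicate_mset (N div G.ord x * H.ord (term_map x)) (term_map x))"
    using map_multiple[OF S N(2)] map_repeat[OF R(1)] by simp
  moreover have "term_map g \<notin>#
      (\<Sum>x\<in>#R. replicate_mset (N div G.ord x * H.ord (term_map x)) (term_map x))"
    using R(2,3) g bij_betw_imp_inj_on[OF term_map_bij]
    by (auto simp: inj_on_def split: if_splits)
  ultimately have "N * count (\<phi> (add_mset g R)) (term_map g) = N div G.ord g * H.ord (term_map g)"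
    by (metis (no_types, lifting) add.right_neutral count_eq_zero_iff count_repeat_mset
        count_replicate_mset count_union image_mset_add_mset sum_mset.add_mset)
  moreover obtain q where "N = G.ord g * q"
    using N(2) by auto
  ultimately have "H.ord (term_map g) = G.ord g * count (\<phi> (add_mset g R)) (term_map g)"
    using N(1) by simp
  then show ?thesis
    by simp
qed

text \<open>Applying divisibility of orders to \<open>\<phi>\<close> and its inverse shows that \<open>term_map\<close> preserves orders. Then
\<open>\<phi>\<close> acts on torsion sequences by applying \<open>term_map\<close> to each term, and product-one sequences
of length two and three show that \<open>term_map\<close> is a half-homomorphism.\<close>

lemma is_iso_torsion_subgroup_large:
  assumes subG: "subgroup (torsion_elements G) G" and subH: "subgroup (torsion_elements H) H"
    and largeG: "\<And>g. \<not> torsion_elements G \<subseteq> {\<one>, g}"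
    and largeH: "\<And>h. \<not> torsion_elements H \<subseteq> {\<one>\<^bsub>H\<^esub>, h}"
  shows "torsion_subgroup G \<cong> torsion_subgroup H"
proof -
  let ?\<psi> = "inv_into (carrier G.B) \<phi>"
  interpret inv: product_one_iso H G ?\<psi>
    by (rule inverse)
  have ord_eq: "H.ord (term_map g) = G.ord g" if g: "g \<in> torsion_elements G" for g
  proof (rule dvd_antisym)
    show "G.ord g dvd H.ord (term_map g)"
      using ord_dvd_ord_term_map[OF subG g largeG] .
    have "?\<psi> (H.torsion_block (term_map g)) = G.torsion_block g"
      using term_map[OF g] g bij_betw_inv_into_left[OF bij] by (metis G.torsion_block_in_B torsion_elements_carrier)
    then have "inv.term_map (term_map g) = g"
      using term_map[OF g] g by (intro inv.term_map_eqI) auto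
    then show "H.ord (term_map g) dvd G.ord g"
      using inv.ord_dvd_ord_term_map[OF subH _ largeH, of "term_map g"] term_map[OF g] by simp
  qed
  have image: "\<phi> S = image_mset term_map S"
    if S: "S \<in> carrier G.B" "set_mset S \<subseteq> torsion_elements G" for S
  proof -
    obtain N where N: "0 < N" "\<forall>x\<in>#S. G.ord x dvd N"
      using G.ex_common_exponent[OF S(2)] .
    have "repeat_mset N (\<phi> S) =
        (\<Sum>x\<in>#S. replicate_mset (N div G.ord x * H.ord (term_map x)) (term_map x))"
      using map_multiple[OF S(2) N(2)] map_repeat[OF S(1)] by simp
    also have "\<dots> = (\<Sum>x\<in>#S. replicate_mset N (term_map x))"
      using S(2) N(2) by (intro arg_cong[of _ _ sum_mset] image_mset_cong) (auto simp: ord_eq)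
    also have "\<dots> = repeat_mset N (image_mset term_map S)"
      by (induction S) auto
    finally show ?thesis
      using N(1) by (simp add: repeat_mset_cancel1)
  qed
  have preserves: "image_mset term_map S \<in> carrier H.B"
    if "S \<in> carrier G.B" "set_mset S \<subseteq> torsion_elements G" for S
    using image[OF that] map_closed[OF that(1)] by simp
  note clG = subgroup.m_closed[OF subG] subgroup.m_inv_closed[OF subG]
  have inv_map: "inv\<^bsub>H\<^esub> (term_map (inv g)) = term_map g" if g: "g \<in> torsion_elements G" for g
  proof -
    have "{#g, inv g#} \<in> carrier G.B"
      using g by (simp add: G.product_one_pair)
    from preserves[OF this] have "{#term_map g, term_map (inv g)#} \<in> carrier H.B"
      using g clG by simp
    then have "term_map g \<otimes>\<^bsub>H\<^esub> term_map (inv g) = \<one>\<^bsub>H\<^esub>"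
      using g clG(2) term_map(1) by (simp add: H.product_one_pair)
    then show ?thesis
      using g clG(2) term_map(1) H.inv_equality by simp
  qed
  interpret half: half_homomorphism "torsion_subgroup G" "torsion_subgroup H" term_map
  proof (unfold half_homomorphism_def half_homomorphism_axioms_def, intro conjI allI impI)
    show "group (torsion_subgroup G)" "group (torsion_subgroup H)"
      using subgroup.subgroup_is_group subG subH G.is_group H.is_group
      by (auto simp: torsion_subgroup_def)
    show "inj_on term_map (carrier (torsion_subgroup G))"
      using term_map_bij by (simp add: torsion_subgroup_def bij_betw_def)
    show "term_map x \<in> carrier (torsion_subgroup H)" if "x \<in> carrier (torsion_subgroup G)" for x
      using that term_map(1) by (simp add: torsion_subgroup_def)
    fix x y assume "x \<in> carrier (torsion_subgroup G)" "y \<in> carrier (torsion_subgroup G)"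
    then have x: "x \<in> torsion_elements G" and y: "y \<in> torsion_elements G"
      by (auto simp: torsion_subgroup_def)
    then have "{#inv (x \<otimes> y), x, y#} \<in> carrier G.B"
      by (subst G.product_one_triple) auto
    from preserves[OF this]
    have "{#term_map (inv (x \<otimes> y)), term_map x, term_map y#} \<in> carrier H.B"
      using x y clG by simp
    then have "inv\<^bsub>H\<^esub> (term_map (inv (x \<otimes> y))) = term_map x \<otimes>\<^bsub>H\<^esub> term_map y \<or>
               inv\<^bsub>H\<^esub> (term_map (inv (x \<otimes> y))) = term_map y \<otimes>\<^bsub>H\<^esub> term_map x"
      using x y clG term_map(1) by (subst (asm) H.product_one_triple) auto
    then show "term_map (x \<otimes>\<^bsub>torsion_subgroup G\<^esub> y) =
        term_map x \<otimes>\<^bsub>torsion_subgroup H\<^esub> term_map y \<or>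
      term_map (x \<otimes>\<^bsub>torsion_subgroup G\<^esub> y) =
        term_map y \<otimes>\<^bsub>torsion_subgroup H\<^esub> term_map x"
      using x y clG inv_map by (simp add: torsion_subgroup_def)
  qed
  show ?thesis
    using term_map_bij by (intro half.bij_imp_is_iso) (simp add: torsion_subgroup_def)
qed

end

section \<open>Groups with at most two elements\<close>

text \<open>The given bijection only compares cardinalities; it is replaced by one that respects the identity.
This is then multiplicative because the square of the other element can only be the identity.\<close>

lemma is_iso_if_two_elements:
  assumes "group K" "group L" and bij: "bij_betw \<theta> (carrier K) (carrier L)"
    and K: "carrier K \<subseteq> {\<one>\<^bsub>K\<^esub>, g}"
  shows "K \<cong> L"
proof -
  interpret K: group K by fact
  interpret L: group L by fact
  have "finite (carrier K)"
    using K by (rule finite_subset) simp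
  then have fin: "finite (carrier K)" "finite (carrier L)"
    using bij_betw_finite[OF bij] by auto
  have card: "card (carrier L) = card (carrier K)"
    using bij_betw_same_card[OF bij] by simp
  obtain f where f: "bij_betw f (carrier K - {\<one>\<^bsub>K\<^esub>}) (carrier L - {\<one>\<^bsub>L\<^esub>})"
    using fin card by (metis K.one_closed L.one_closed card_Diff_singleton finite_Diff finite_same_card_bij)
  let ?f = "\<lambda>x. if x = \<one>\<^bsub>K\<^esub> then \<one>\<^bsub>L\<^esub> else f x"
  have b: "bij_betw ?f (carrier K) (carrier L)"
  proof -
    have "bij_betw ?f (carrier K - {\<one>\<^bsub>K\<^esub>}) (carrier L - {\<one>\<^bsub>L\<^esub>})"
      using f by (rule bij_betw_cong[THEN iffD1, rotated]) auto
    then have "bij_betw ?f (carrier K - {\<one>\<^bsub>K\<^esub>} \<union> {\<one>\<^bsub>K\<^esub>}) (carrier L - {\<one>\<^bsub>L\<^esub>} \<union> {?f \<one>\<^bsub>K\<^esub>})"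
      by (subst notIn_Un_bij_betw3[symmetric]) auto
    then show ?thesis
      by (simp add: insert_absorb)
  qed
  have sq: "x \<otimes>\<^bsub>M\<^esub> x = \<one>\<^bsub>M\<^esub>"
    if "group M" "x \<in> carrier M" "\<And>y. y \<in> carrier M \<Longrightarrow> y = \<one>\<^bsub>M\<^esub> \<or> y = x" for x and M :: "('z, 'y) monoid_scheme"
    using that group.is_monoid monoid.m_closed[of M x x] group.l_cancel_one[of M x x] by metis
  have "?f (x \<otimes>\<^bsub>K\<^esub> y) = ?f x \<otimes>\<^bsub>L\<^esub> ?f y" if xy: "x \<in> carrier K" "y \<in> carrier K" for x y
  proof (cases "x = \<one>\<^bsub>K\<^esub> \<or> y = \<one>\<^bsub>K\<^esub>")
    case True
    then show ?thesis
      using xy b bij_betwE[OF b] by auto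
  next
    case False
    then have eq: "y = x" and onlyx: "\<And>z. z \<in> carrier K \<Longrightarrow> z = \<one>\<^bsub>K\<^esub> \<or> z = x"
      using xy K by blast+
    have "carrier L = ?f ` carrier K"
      using b by (simp add: bij_betw_def)
    then have "\<And>z. z \<in> carrier L \<Longrightarrow> z = \<one>\<^bsub>L\<^esub> \<or> z = ?f x"
      using onlyx by fastforce
    then show ?thesis
      using sq[OF assms(2), of "?f x"] sq[OF assms(1), of x] onlyx xy(1) eq bij_betwE[OF b] by auto
  qed
  then have "?f \<in> hom K L"
    by (intro homI bij_betwE[OF b, rule_format])
  then have "?f \<in> iso K L"
    using b by (simp only: iso_def mem_Collect_eq simp_thms)
  then show ?thesis
    unfolding is_iso_def by blast
qed

theorem corollary1p2:
  fixes G\<^sub>1 :: "('a, 'm) monoid_scheme" and G\<^sub>2 :: "('b, 'n) monoid_scheme"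
  assumes "group G\<^sub>1" and "group G\<^sub>2"
    and "torsion_group (commutator_subgroup G\<^sub>1)"
    and "torsion_group (commutator_subgroup G\<^sub>2)"
    and "product_one_monoid G\<^sub>1 \<cong> product_one_monoid G\<^sub>2"
  shows "torsion_subgroup G\<^sub>1 \<cong> torsion_subgroup G\<^sub>2"
proof -
  obtain \<phi> where "\<phi> \<in> iso (product_one_monoid G\<^sub>1) (product_one_monoid G\<^sub>2)"
    using assms(5) by (auto simp: is_iso_def)
  then interpret product_one_iso G\<^sub>1 G\<^sub>2 \<phi>
    using assms(1,2) by (simp add: product_one_iso_def product_one_iso_axioms_def)
  have sub: "subgroup (torsion_elements G\<^sub>1) G\<^sub>1" "subgroup (torsion_elements G\<^sub>2) G\<^sub>2"
    using assms(3,4) G.subgroup_torsion_elements H.subgroup_torsion_elements by auto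
  have gr: "group (torsion_subgroup G\<^sub>1)" "group (torsion_subgroup G\<^sub>2)"
    using subgroup.subgroup_is_group sub assms(1,2) by (auto simp: torsion_subgroup_def)
  have b: "bij_betw term_map (carrier (torsion_subgroup G\<^sub>1)) (carrier (torsion_subgroup G\<^sub>2))"
    using term_map_bij by (simp add: torsion_subgroup_def)
  consider (small1) g where "torsion_elements G\<^sub>1 \<subseteq> {\<one>\<^bsub>G\<^sub>1\<^esub>, g}"
    | (small2) h where "torsion_elements G\<^sub>2 \<subseteq> {\<one>\<^bsub>G\<^sub>2\<^esub>, h}"
    | (large) "\<And>g. \<not> torsion_elements G\<^sub>1 \<subseteq> {\<one>\<^bsub>G\<^sub>1\<^esub>, g}" "\<And>h. \<not> torsion_elements G\<^sub>2 \<subseteq> {\<one>\<^bsub>G\<^sub>2\<^esub>, h}"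
    by metis
  then show ?thesis
  proof cases
    case small1
    then show ?thesis
      using is_iso_if_two_elements[OF gr b] by (simp add: torsion_subgroup_def)
  next
    case small2
    then have "torsion_subgroup G\<^sub>2 \<cong> torsion_subgroup G\<^sub>1"
      using is_iso_if_two_elements[OF gr(2,1) bij_betw_inv_into[OF b]] by (simp add: torsion_subgroup_def)
    then show ?thesis
      using group.iso_sym gr(2) by blast
  next
    case large
    then show ?thesis
      using is_iso_torsion_subgroup_large sub by blast
  qed
qed

end
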